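(* Let $F$ and $F'$ be real closed fields, and let $A = F[X,Y]/(X^2+Y^2+1)$ and $A' = F'[X,Y]/(X^2+Y^2+1)$. If $F$ and $F'$ are not isomorphic, then the rings $A$ and $A'$ are not isomorphic.
   Context: A formally real field is a field in which $-1$ is not a sum of squares (equivalently, a field that admits a total order making it an ordered field). A real closed field $F$ is a formally real field such that $F(\sqrt{-1}) = F[X]/(X^2+1)$ is algebraically closed. Isomorphic means isomorphic as fields for $F, F'$ and as rings for $A, A'$. *)

theory Defs
  imports "HOL-Algebra.Algebra"
begin

locale formally_real_field = field F for F (structure) +
  assumes minus_one_not_sum_of_squares:
    "x \<in> {..<n::nat} \<rightarrow> carrier F \<Longrightarrow> (\<Oplus>i\<in>{..<n}. x i [^] (2::nat)) \<noteq> \<ominus> \<one>"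

definition adjoin_sqrt_minus_one :: "('a, 'm) ring_scheme \<Rightarrow> 'a list set ring" where
  "adjoin_sqrt_minus_one F =
     (let P = poly_ring F
      in P Quot (PIdl\<^bsub>P\<^esub> (X\<^bsub>F\<^esub> [^]\<^bsub>P\<^esub> (2::nat) \<oplus>\<^bsub>P\<^esub> \<one>\<^bsub>P\<^esub>)))"

locale real_closed_field = formally_real_field +
  assumes algebraically_closed_adjoin_sqrt_minus_one:
    "algebraically_closed (adjoin_sqrt_minus_one F)"

text \<open>The ring \<open>F[X,Y]\<close> is realised as \<open>(F[X])[Y]\<close>: its elements are lists over
  \<^term>\<open>carrier (poly_ring F)\<close>. The inner variable \<open>X\<close> has to be embedded as a constant
  polynomial in \<open>Y\<close>.\<close>

definition conic_ring :: "('a, 'm) ring_scheme \<Rightarrow> 'a list list set ring" where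
  "conic_ring F =
     (let P = poly_ring F;
          Q = poly_ring P;
          x = ring.poly_of_const P X\<^bsub>F\<^esub>;
          y = X\<^bsub>P\<^esub>
      in Q Quot (PIdl\<^bsub>Q\<^esub> (x [^]\<^bsub>Q\<^esub> (2::nat) \<oplus>\<^bsub>Q\<^esub> y [^]\<^bsub>Q\<^esub> (2::nat) \<oplus>\<^bsub>Q\<^esub> \<one>\<^bsub>Q\<^esub>)))"

end

theory Submission
  imports Defs
begin

text \<open>
  The field \<open>F\<close> can be recovered from the ring \<open>A = F[X,Y]/(X\<^sup>2 + Y\<^sup>2 + 1)\<close> alone: it consists of zero
  and the units of \<open>A\<close>. Any ring isomorphism preserves this subset, so it restricts to an
  isomorphism of the fields.

  To find the units, regard \<open>A\<close> as the quadratic extension \<open>P[Y]/(Y\<^sup>2 + d)\<close> of \<open>P = F[X]\<close> with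
  \<open>d = X\<^sup>2 + 1\<close>. Every element has exactly one representative \<open>a + b Y\<close> with \<open>a, b \<in> P\<close>, and the norm
  \<open>a\<^sup>2 + d b\<^sup>2\<close> is multiplicative, so the norm of a unit of \<open>A\<close> is a unit of \<open>P\<close>, that is, a nonzero
  constant (\<open>unit_quadratic_extensionE\<close>). If \<open>b\<close> were nonzero, the norm would have positive degree: the
  leading terms of \<open>a\<^sup>2\<close> and \<open>(X\<^sup>2 + 1) b\<^sup>2\<close> can only cancel if two squares in \<open>F\<close>, one of
  them nonzero, add up to zero, which would make \<open>-1\<close> a square. Hence \<open>b = 0\<close> and \<open>a\<close> is a constant
  (\<open>norm_unit_imp_const\<close>). Geometrically, the conic has no points at infinity over \<open>F\<close>.
\<close>

section \<open>Residues modulo a quadratic\<close>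

text \<open>The product of two linear polynomials in \<open>Y\<close> is reduced by \<open>Y\<^sup>2 = -D\<close>; the subtracted \<open>\<one>\<close> makes
  this the linear representative of \<open>x y - 1\<close>, which vanishes when the factors are mutually inverse.\<close>

lemma (in cring) linear_product_mod_quadratic:
  assumes "A \<in> carrier R" "B \<in> carrier R" "C \<in> carrier R" "D \<in> carrier R" "E \<in> carrier R"
    "Y \<in> carrier R"
  shows "(A \<otimes> C \<ominus> D \<otimes> (B \<otimes> E) \<ominus> \<one>) \<oplus> (A \<otimes> E \<oplus> B \<otimes> C) \<otimes> Y
      = (A \<oplus> B \<otimes> Y) \<otimes> (C \<oplus> E \<otimes> Y) \<ominus> \<one> \<ominus> (Y \<otimes> Y \<oplus> D) \<otimes> (B \<otimes> E)"
  using assms by algebra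

lemma (in cring) inverse_mod_multiple:
  assumes carr: "L \<in> carrier R" "F \<in> carrier R" "S \<in> carrier R" "M \<in> carrier R" "T \<in> carrier R"
    "G \<in> carrier R"
    and inverse: "L \<otimes> (F \<otimes> S \<oplus> M) = F \<otimes> T \<oplus> \<one>"
  shows "L \<otimes> M \<ominus> \<one> \<ominus> F \<otimes> G = F \<otimes> (T \<ominus> L \<otimes> S \<ominus> G)"
proof -
  have "L \<otimes> M = L \<otimes> (F \<otimes> S \<oplus> M) \<ominus> F \<otimes> (L \<otimes> S)"
    using carr by algebra
  then have "L \<otimes> M = (F \<otimes> T \<oplus> \<one>) \<ominus> F \<otimes> (L \<otimes> S)"
    unfolding inverse .
  then show ?thesis
    using carr by algebra
qed

text \<open>Brahmagupta's identity: the norm from the quadratic extension is multiplicative.\<close>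

lemma (in cring) norm_form_mult:
  assumes "a \<in> carrier R" "b \<in> carrier R" "c \<in> carrier R" "e \<in> carrier R" "d \<in> carrier R"
  shows "(a \<otimes> a \<oplus> d \<otimes> (b \<otimes> b)) \<otimes> (c \<otimes> c \<oplus> d \<otimes> (e \<otimes> e))
      = (a \<otimes> c \<ominus> d \<otimes> (b \<otimes> e)) \<otimes> (a \<otimes> c \<ominus> d \<otimes> (b \<otimes> e))
        \<oplus> d \<otimes> ((a \<otimes> e \<oplus> b \<otimes> c) \<otimes> (a \<otimes> e \<oplus> b \<otimes> c))"
  using assms by algebra

context domain
begin

definition quadratic :: "'a \<Rightarrow> 'a list"
  where "quadratic d = X [^]\<^bsub>poly_ring R\<^esub> (2::nat) \<oplus>\<^bsub>poly_ring R\<^esub> poly_of_const d"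

definition linear :: "'a \<Rightarrow> 'a \<Rightarrow> 'a list"
  where "linear a b = poly_of_const a \<oplus>\<^bsub>poly_ring R\<^esub> poly_of_const b \<otimes>\<^bsub>poly_ring R\<^esub> X"

lemma poly_of_const_ring_hom_ring: "ring_hom_ring R (poly_ring R) poly_of_const"
  using canonical_embedding_ring_hom[OF carrier_is_subring] by simp

lemma linear_eq_normalize:
  assumes "a \<in> carrier R" "b \<in> carrier R"
  shows "linear a b = normalize [b, a]"
proof -
  have "poly_of_const b \<in> carrier (poly_ring R)"
    using ring_hom_ring.homh[OF poly_of_const_ring_hom_ring] assms(2) by (rule ring_hom_memE)
  then have "poly_of_const b \<otimes>\<^bsub>poly_ring R\<^esub> X = normalize [b, \<zero>]"
    using poly_mult_var[OF carrier_is_subring, of "poly_of_const b"] assms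
    by (auto simp: poly_of_const_def split: if_splits)
  then show ?thesis
    unfolding linear_def using assms by (auto simp: univ_poly_add poly_of_const_def)
qed

lemma quadratic_eq_list:
  assumes "d \<in> carrier R"
  shows "quadratic d = [\<one>, \<zero>, d]"
proof -
  have "X [^]\<^bsub>poly_ring R\<^esub> (2::nat) = [\<one>, \<zero>, \<zero>]"
    using unitary_monom_eq_var_pow[OF carrier_is_subring, of 2]
    by (simp add: monom_def numeral_2_eq_2)
  then show ?thesis
    unfolding quadratic_def using assms by (auto simp: univ_poly_add poly_of_const_def)
qed

lemma quadratic_closed:
  assumes "d \<in> carrier R"
  shows "quadratic d \<in> carrier (poly_ring R)"
  using assms by (simp add: quadratic_eq_list univ_poly_carrier[symmetric] polynomial_def)

lemma linear_closed:
  assumes "a \<in> carrier R" "b \<in> carrier R"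
  shows "linear a b \<in> carrier (poly_ring R)"
  unfolding linear_eq_normalize[OF assms] univ_poly_carrier[symmetric]
  using assms by (intro normalize_gives_polynomial) simp

text \<open>Division with remainder works over any domain because the quadratic is monic.\<close>

lemma division_by_quadratic:
  assumes "d \<in> carrier R" and "p \<in> carrier (poly_ring R)"
  obtains s a b where "s \<in> carrier (poly_ring R)" "a \<in> carrier R" "b \<in> carrier R"
    "p = quadratic d \<otimes>\<^bsub>poly_ring R\<^esub> s \<oplus>\<^bsub>poly_ring R\<^esub> linear a b"
proof -
  have f: "polynomial (carrier R) [\<one>, \<zero>, d]"
    using assms by (auto simp: polynomial_def)
  obtain s r where s: "polynomial (carrier R) s" and r: "polynomial (carrier R) r"
    and p: "p = [\<one>, \<zero>, d] \<otimes>\<^bsub>poly_ring R\<^esub> s \<oplus>\<^bsub>poly_ring R\<^esub> r"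
    and deg: "r = [] \<or> degree r < degree [\<one>, \<zero>, d]"
    using long_division_theorem[OF carrier_is_subring, of p "[\<one>, \<zero>, d]"] f assms(2)
    by (auto simp: univ_poly_carrier)
  have "\<exists>a\<in>carrier R. \<exists>b\<in>carrier R. r = normalize [b, a]"
  proof -
    consider "r = []" | c where "r = [c]" | c e where "r = [c, e]"
      using deg by (cases r; cases "tl r"; cases "tl (tl r)") auto
    then show ?thesis
    proof cases
      case 1
      then show ?thesis by (intro bexI[of _ \<zero>]) auto
    next
      case 2
      then show ?thesis using r
        by (intro bexI[of _ c] bexI[of _ \<zero>]) (auto simp: polynomial_def)
    next
      case 3
      then show ?thesis using r
        by (intro bexI[of _ e] bexI[of _ c]) (auto simp: polynomial_def)
    qed
  qed
  then show thesis
    using that[of s] s p by (auto simp: univ_poly_carrier linear_eq_normalize quadratic_eq_list assms)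
qed

text \<open>A nonzero multiple of a monic quadratic has degree at least two. This makes the linear
  representative of a residue class unique.\<close>

lemma linear_multiple_of_quadratic:
  assumes "d \<in> carrier R" "a \<in> carrier R" "b \<in> carrier R" and "s \<in> carrier (poly_ring R)"
    and "linear a b = quadratic d \<otimes>\<^bsub>poly_ring R\<^esub> s"
  shows "a = \<zero>" and "b = \<zero>"
proof -
  have f: "polynomial (carrier R) [\<one>, \<zero>, d]"
    using assms by (auto simp: polynomial_def)
  have eq: "normalize [b, a] = poly_mult [\<one>, \<zero>, d] s"
    using assms(5)[unfolded linear_eq_normalize[OF assms(2,3)] quadratic_eq_list[OF assms(1)]]
    by (simp only: univ_poly_mult)
  have "s = []"
  proof (rule ccontr)
    assume "s \<noteq> []"
    then have "degree (poly_mult [\<one>, \<zero>, d] s) = 2 + degree s"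
      using poly_mult_degree_eq[OF carrier_is_subring f, of s] assms(4)
      by (simp add: univ_poly_carrier del: poly_mult.simps)
    then have "degree (normalize [b, a]) = 2 + degree s"
      unfolding eq .
    then show False by (auto split: if_splits)
  qed
  then have "normalize [b, a] = []"
    using eq poly_mult_zero(2)[of "[\<one>, \<zero>, d]"] assms by (simp del: poly_mult.simps)
  then show "a = \<zero>" "b = \<zero>" by (auto split: if_splits)
qed

text \<open>Write the inverse of \<open>a + b Y\<close> as \<open>c + e Y\<close>. By uniqueness of linear representatives the product has
  coefficients \<open>ac - dbe = 1\<close> and \<open>ae + bc = 0\<close>, so the two norms are inverse to each other.\<close>

lemma norm_of_unit_mod_quadratic:
  assumes d: "d \<in> carrier R" and ab: "a \<in> carrier R" "b \<in> carrier R"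
    and q: "q \<in> carrier (poly_ring R)" and t: "t \<in> carrier (poly_ring R)"
    and inverse: "linear a b \<otimes>\<^bsub>poly_ring R\<^esub> q
      = quadratic d \<otimes>\<^bsub>poly_ring R\<^esub> t \<oplus>\<^bsub>poly_ring R\<^esub> \<one>\<^bsub>poly_ring R\<^esub>"
  shows "a \<otimes> a \<oplus> d \<otimes> (b \<otimes> b) \<in> Units R"
proof -
  interpret C: ring_hom_ring R "poly_ring R" poly_of_const
    by (rule poly_of_const_ring_hom_ring)
  interpret Q: domain "poly_ring R"
    by (rule univ_poly_is_domain[OF carrier_is_subring])
  let ?Q = "poly_ring R" and ?f = "quadratic d" and ?c = poly_of_const
  have Y: "X \<in> carrier ?Q" by (rule var_closed(1)[OF carrier_is_subring])
  obtain s c e where s: "s \<in> carrier ?Q" and ce: "c \<in> carrier R" "e \<in> carrier R"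
    and qs: "q = ?f \<otimes>\<^bsub>?Q\<^esub> s \<oplus>\<^bsub>?Q\<^esub> linear c e"
    using division_by_quadratic[OF d q] .
  let ?re = "a \<otimes> c \<ominus> d \<otimes> (b \<otimes> e) \<ominus> \<one>" and ?im = "a \<otimes> e \<oplus> b \<otimes> c"
  let ?w = "t \<ominus>\<^bsub>?Q\<^esub> linear a b \<otimes>\<^bsub>?Q\<^esub> s \<ominus>\<^bsub>?Q\<^esub> ?c (b \<otimes> e)"
  note hom = C.hom_closed[OF d] C.hom_closed[OF ab(1)] C.hom_closed[OF ab(2)]
    C.hom_closed[OF ce(1)] C.hom_closed[OF ce(2)]
  have Y2: "X [^]\<^bsub>?Q\<^esub> (2::nat) = X \<otimes>\<^bsub>?Q\<^esub> X"
    using Y by (simp add: numeral_2_eq_2)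
  have w: "?w \<in> carrier ?Q"
    using hom Y s t ab ce linear_closed[OF ab] by simp
  have const: "?c ?re = ?c a \<otimes>\<^bsub>?Q\<^esub> ?c c \<ominus>\<^bsub>?Q\<^esub> ?c d \<otimes>\<^bsub>?Q\<^esub> (?c b \<otimes>\<^bsub>?Q\<^esub> ?c e) \<ominus>\<^bsub>?Q\<^esub> \<one>\<^bsub>?Q\<^esub>"
    "?c ?im = ?c a \<otimes>\<^bsub>?Q\<^esub> ?c e \<oplus>\<^bsub>?Q\<^esub> ?c b \<otimes>\<^bsub>?Q\<^esub> ?c c"
    "?c (b \<otimes> e) = ?c b \<otimes>\<^bsub>?Q\<^esub> ?c e"
    using d ab ce by (simp_all add: a_minus_def)
  have "linear ?re ?im = linear a b \<otimes>\<^bsub>?Q\<^esub> linear c e \<ominus>\<^bsub>?Q\<^esub> \<one>\<^bsub>?Q\<^esub>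
      \<ominus>\<^bsub>?Q\<^esub> ?f \<otimes>\<^bsub>?Q\<^esub> ?c (b \<otimes> e)"
    unfolding linear_def quadratic_def Y2 const
    by (rule Q.linear_product_mod_quadratic[OF hom(2,3,4,1,5) Y])
  also have "\<dots> = ?f \<otimes>\<^bsub>?Q\<^esub> ?w"
    using Q.inverse_mod_multiple[OF linear_closed[OF ab] quadratic_closed[OF d] s linear_closed[OF ce] t
        C.hom_closed[OF m_closed[OF ab(2) ce(2)]] inverse[unfolded qs]] .
  finally have "linear ?re ?im = ?f \<otimes>\<^bsub>?Q\<^esub> ?w" .
  then have "?re = \<zero>" "?im = \<zero>"
    using linear_multiple_of_quadratic[OF d _ _ w, of ?re ?im] d ab ce by auto
  then have re: "a \<otimes> c \<ominus> d \<otimes> (b \<otimes> e) = \<one>" and im: "?im = \<zero>"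
    using d ab ce by auto
  have "(a \<otimes> a \<oplus> d \<otimes> (b \<otimes> b)) \<otimes> (c \<otimes> c \<oplus> d \<otimes> (e \<otimes> e))
      = (a \<otimes> c \<ominus> d \<otimes> (b \<otimes> e)) \<otimes> (a \<otimes> c \<ominus> d \<otimes> (b \<otimes> e)) \<oplus> d \<otimes> (?im \<otimes> ?im)"
    by (rule norm_form_mult[OF ab ce d])
  also have "\<dots> = \<one>"
    unfolding re im using d by simp
  finally have "(a \<otimes> a \<oplus> d \<otimes> (b \<otimes> b)) \<otimes> (c \<otimes> c \<oplus> d \<otimes> (e \<otimes> e)) = \<one>" .
  moreover have "a \<otimes> a \<oplus> d \<otimes> (b \<otimes> b) \<in> carrier R" "c \<otimes> c \<oplus> d \<otimes> (e \<otimes> e) \<in> carrier R"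
    using d ab ce by simp_all
  ultimately show ?thesis
    using m_comm unfolding Units_def by fastforce
qed

abbreviation quadratic_extension :: "'a \<Rightarrow> 'a list set ring"
  where "quadratic_extension d \<equiv> poly_ring R Quot (PIdl\<^bsub>poly_ring R\<^esub> (quadratic d))"

abbreviation residue :: "'a \<Rightarrow> 'a list \<Rightarrow> 'a list set"
  where "residue d p \<equiv> (PIdl\<^bsub>poly_ring R\<^esub> (quadratic d)) +>\<^bsub>poly_ring R\<^esub> p"

lemma residue_ring_hom_ring:
  assumes "d \<in> carrier R"
  shows "ring_hom_ring (poly_ring R) (quadratic_extension d) (residue d)"
  using cring.cgenideal_ideal[OF univ_poly_is_cring[OF carrier_is_subring] quadratic_closed[OF assms]]
  by (rule ideal.rcos_ring_hom_ring)

lemma residue_eqD: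
  assumes d: "d \<in> carrier R" and p: "p \<in> carrier (poly_ring R)" and q: "q \<in> carrier (poly_ring R)"
    and eq: "residue d p = residue d q"
  obtains s where "s \<in> carrier (poly_ring R)" "p = quadratic d \<otimes>\<^bsub>poly_ring R\<^esub> s \<oplus>\<^bsub>poly_ring R\<^esub> q"
proof -
  interpret Q: domain "poly_ring R"
    by (rule univ_poly_is_domain[OF carrier_is_subring])
  note f = quadratic_closed[OF d]
  have "p \<ominus>\<^bsub>poly_ring R\<^esub> q \<in> PIdl\<^bsub>poly_ring R\<^esub> (quadratic d)"
    using Q.quotient_eq_iff_same_a_r_cos[OF Q.cgenideal_ideal[OF f] p q] eq by simp
  then obtain s where s: "s \<in> carrier (poly_ring R)"
    and eq': "p \<ominus>\<^bsub>poly_ring R\<^esub> q = s \<otimes>\<^bsub>poly_ring R\<^esub> quadratic d"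
    unfolding cgenideal_def by blast
  have "p = (p \<ominus>\<^bsub>poly_ring R\<^esub> q) \<oplus>\<^bsub>poly_ring R\<^esub> q"
    using p q by algebra
  then show thesis
    using that[OF s] unfolding eq' Q.m_comm[OF s f] by blast
qed

text \<open>Constants embed into the extension, being linear polynomials.\<close>

lemma residue_const_eq_zeroD:
  assumes d: "d \<in> carrier R" and a: "a \<in> carrier R"
    and "residue d (poly_of_const a) = \<zero>\<^bsub>quadratic_extension d\<^esub>"
  shows "a = \<zero>"
proof -
  interpret Q: domain "poly_ring R"
    by (rule univ_poly_is_domain[OF carrier_is_subring])
  interpret C: ring_hom_ring R "poly_ring R" poly_of_const
    by (rule poly_of_const_ring_hom_ring)
  interpret res: ring_hom_ring "poly_ring R" "quadratic_extension d" "residue d"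
    by (rule residue_ring_hom_ring[OF d])
  have "residue d (poly_of_const a) = residue d \<zero>\<^bsub>poly_ring R\<^esub>"
    unfolding res.hom_zero assms(3) ..
  then obtain s where s: "s \<in> carrier (poly_ring R)"
    and eq: "poly_of_const a = quadratic d \<otimes>\<^bsub>poly_ring R\<^esub> s \<oplus>\<^bsub>poly_ring R\<^esub> \<zero>\<^bsub>poly_ring R\<^esub>"
    by (rule residue_eqD[OF d C.hom_closed[OF a] Q.zero_closed])
  have "linear a \<zero> = quadratic d \<otimes>\<^bsub>poly_ring R\<^esub> s"
    using eq a s quadratic_closed[OF d] var_closed(1)[OF carrier_is_subring]
    by (simp add: linear_def)
  then show ?thesis
    using linear_multiple_of_quadratic(1)[OF d a zero_closed s] by blast
qed

lemma unit_quadratic_extensionE: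
  assumes d: "d \<in> carrier R" and u: "u \<in> Units (quadratic_extension d)"
  obtains a b where "a \<in> carrier R" "b \<in> carrier R" "u = residue d (linear a b)"
    "a \<otimes> a \<oplus> d \<otimes> (b \<otimes> b) \<in> Units R"
proof -
  let ?Q = "poly_ring R"
  interpret Q: domain ?Q
    by (rule univ_poly_is_domain[OF carrier_is_subring])
  interpret res: ring_hom_ring ?Q "quadratic_extension d" "residue d"
    by (rule residue_ring_hom_ring[OF d])
  note f = quadratic_closed[OF d]
  interpret I: ideal "PIdl\<^bsub>?Q\<^esub> (quadratic d)" ?Q
    by (rule Q.cgenideal_ideal[OF f])
  have surj: "\<exists>p\<in>carrier ?Q. v = residue d p" if "v \<in> carrier (quadratic_extension d)" for v
    using that unfolding FactRing_def A_RCOSETS_def' by auto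
  obtain v where uc: "u \<in> carrier (quadratic_extension d)" and vc: "v \<in> carrier (quadratic_extension d)"
    and uv: "u \<otimes>\<^bsub>quadratic_extension d\<^esub> v = \<one>\<^bsub>quadratic_extension d\<^esub>"
    using u unfolding Units_def by blast
  obtain p where p: "p \<in> carrier ?Q" "u = residue d p"
    using surj[OF uc] ..
  obtain q where q: "q \<in> carrier ?Q" "v = residue d q"
    using surj[OF vc] ..
  obtain s a b where s: "s \<in> carrier ?Q" and a: "a \<in> carrier R" and b: "b \<in> carrier R"
    and ps: "p = quadratic d \<otimes>\<^bsub>?Q\<^esub> s \<oplus>\<^bsub>?Q\<^esub> linear a b"
    using division_by_quadratic[OF d p(1)] .
  note lin = linear_closed[OF a b]
  have "linear a b \<ominus>\<^bsub>?Q\<^esub> p = \<ominus>\<^bsub>?Q\<^esub> s \<otimes>\<^bsub>?Q\<^esub> quadratic d"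
    unfolding ps using f s lin by algebra
  then have "linear a b \<ominus>\<^bsub>?Q\<^esub> p \<in> PIdl\<^bsub>?Q\<^esub> (quadratic d)"
    using s unfolding cgenideal_def by blast
  then have u_lin: "u = residue d (linear a b)"
    using Q.quotient_eq_iff_same_a_r_cos[OF I.ideal_axioms lin p(1)] p(2) by simp
  have "residue d (linear a b \<otimes>\<^bsub>?Q\<^esub> q) = residue d \<one>\<^bsub>?Q\<^esub>"
    using uv unfolding u_lin q(2) res.hom_mult[OF lin q(1)] res.hom_one .
  then obtain t where "t \<in> carrier ?Q"
    "linear a b \<otimes>\<^bsub>?Q\<^esub> q = quadratic d \<otimes>\<^bsub>?Q\<^esub> t \<oplus>\<^bsub>?Q\<^esub> \<one>\<^bsub>?Q\<^esub>"
    by (rule residue_eqD[OF d Q.m_closed[OF lin q(1)] Q.one_closed])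
  then have "a \<otimes> a \<oplus> d \<otimes> (b \<otimes> b) \<in> Units R"
    using norm_of_unit_mod_quadratic[OF d a b q(1)] by blast
  then show thesis
    using that a b u_lin by blast
qed

end

section \<open>Sums of two squares of polynomials\<close>

text \<open>The degrees of \<open>a\<^sup>2\<close> and \<open>(X\<^sup>2 + 1) b\<^sup>2\<close> rule out cancellation unless they agree, and then the
  coefficient of the sum in that degree is a sum of two squares of leading coefficients.\<close>

lemma (in field) norm_unit_imp_const:
  assumes nonsquare: "\<And>x. x \<in> carrier R \<Longrightarrow> x \<otimes> x \<noteq> \<ominus> \<one>"
    and d: "d = X [^]\<^bsub>poly_ring R\<^esub> (2::nat) \<oplus>\<^bsub>poly_ring R\<^esub> \<one>\<^bsub>poly_ring R\<^esub>"
    and a: "a \<in> carrier (poly_ring R)" and b: "b \<in> carrier (poly_ring R)"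
    and unit: "a \<otimes>\<^bsub>poly_ring R\<^esub> a \<oplus>\<^bsub>poly_ring R\<^esub> d \<otimes>\<^bsub>poly_ring R\<^esub> (b \<otimes>\<^bsub>poly_ring R\<^esub> b)
      \<in> Units (poly_ring R)"
  shows "b = []" and "a \<in> poly_of_const ` carrier R"
proof -
  let ?P = "poly_ring R"
  let ?u = "a \<otimes>\<^bsub>?P\<^esub> a" and ?v = "d \<otimes>\<^bsub>?P\<^esub> (b \<otimes>\<^bsub>?P\<^esub> b)"
  interpret P: domain ?P by (rule univ_poly_is_domain[OF carrier_is_subring])
  note pol = univ_poly_carrier[symmetric]
  note deg_mult = poly_mult_degree_eq[OF carrier_is_subring, folded univ_poly_mult[of R "carrier R"], unfolded univ_poly_carrier]
  note lc_mult = poly_mult_lead_coeff[OF carrier_is_subring, folded univ_poly_mult[of R "carrier R"], unfolded univ_poly_carrier]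
  have d_list: "d = [\<one>, \<zero>, \<one>]"
    using quadratic_eq_list[of \<one>] by (simp add: d quadratic_def poly_of_const_def univ_poly_one)
  have dP: "d \<in> carrier ?P"
    unfolding d_list univ_poly_carrier[symmetric] polynomial_def by simp
  have u: "?u \<in> carrier ?P" and v: "?v \<in> carrier ?P"
    using a b dP by auto
  have deg0: "degree (?u \<oplus>\<^bsub>?P\<^esub> ?v) = 0"
    using unit univ_poly_units'[OF carrier_is_subfield] by blast
  have deg_u: "degree ?u = 2 * degree a"
    using deg_mult[OF a a] by auto
  have bb: "b \<otimes>\<^bsub>?P\<^esub> b \<noteq> []" if "b \<noteq> []"
    using P.integral[OF _ b b] that by (auto simp: univ_poly_zero)
  have deg_v: "degree ?v = 2 + 2 * degree b" if "b \<noteq> []"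
  proof -
    have "degree ?v = degree d + degree (b \<otimes>\<^bsub>?P\<^esub> b)"
      using deg_mult[OF dP, of "b \<otimes>\<^bsub>?P\<^esub> b"] b that bb
      by (simp add: d_list)
    also have "\<dots> = 2 + 2 * degree b"
      using deg_mult[OF b b] that by (simp add: d_list)
    finally show ?thesis .
  qed
  show "b = []"
  proof (rule ccontr)
    assume "b \<noteq> []"
    have "degree ?u = degree ?v"
    proof (rule ccontr)
      assume "degree ?u \<noteq> degree ?v"
      then have "degree (?u \<oplus>\<^bsub>?P\<^esub> ?v) = max (degree ?u) (degree ?v)"
        using poly_add_degree_eq[OF carrier_is_subring, of ?u ?v] u v
        by (simp add: univ_poly_add univ_poly_carrier)
      then show False using deg0 deg_v[OF \<open>b \<noteq> []\<close>] by simp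
    qed
    then have deg: "degree ?u = degree ?v" "degree ?u > 0" and "a \<noteq> []"
      using deg_u deg_v[OF \<open>b \<noteq> []\<close>] by auto
    define k where "k = degree ?u"
    have lc: "lead_coeff a \<in> carrier R" "lead_coeff b \<in> carrier R" "lead_coeff b \<noteq> \<zero>"
      using a b \<open>a \<noteq> []\<close> \<open>b \<noteq> []\<close> by (auto simp: pol polynomial_def)
    have lc_v: "lead_coeff ?v = lead_coeff b \<otimes> lead_coeff b"
      using lc_mult[OF dP, of "b \<otimes>\<^bsub>?P\<^esub> b"] lc_mult[OF b b] b lc \<open>b \<noteq> []\<close> bb
      by (simp add: d_list)
    have lc_u: "lead_coeff ?u = lead_coeff a \<otimes> lead_coeff a"
      using lc_mult[OF a a] \<open>a \<noteq> []\<close> by simp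
    have ne: "?u \<noteq> []" "?v \<noteq> []"
      using deg by auto
    have "coeff (?u \<oplus>\<^bsub>?P\<^esub> ?v) k = coeff ?u k \<oplus> coeff ?v k"
      using poly_add_coeff[of ?u ?v] u v polynomial_in_carrier[OF carrier_is_subring]
      by (simp add: univ_poly_add univ_poly_carrier)
    also have "\<dots> = lead_coeff a \<otimes> lead_coeff a \<oplus> lead_coeff b \<otimes> lead_coeff b"
      using lead_coeff_simp[OF ne(1)] lead_coeff_simp[OF ne(2)] deg lc_u lc_v
      by (simp add: k_def)
    also have "coeff (?u \<oplus>\<^bsub>?P\<^esub> ?v) k = \<zero>"
      using coeff_degree deg0 deg(2) by (simp add: k_def)
    finally have sum: "lead_coeff a \<otimes> lead_coeff a \<oplus> lead_coeff b \<otimes> lead_coeff b = \<zero>" ..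
    \<comment> \<open>Dividing by the nonzero leading coefficient of \<open>b\<close> exhibits \<open>-1\<close> as a square.\<close>
    define x where "x = inv (lead_coeff b)"
    have x: "x \<in> carrier R" "lead_coeff b \<otimes> x = \<one>"
      using lc field_Units by (auto simp: x_def)
    define y where "y = lead_coeff b"
    define z where "z = lead_coeff a"
    have "(z \<otimes> x) \<otimes> (z \<otimes> x) \<oplus> \<one> = (z \<otimes> x) \<otimes> (z \<otimes> x) \<oplus> (y \<otimes> x) \<otimes> (y \<otimes> x)"
      using x by (simp add: y_def)
    also have "\<dots> = (z \<otimes> z \<oplus> y \<otimes> y) \<otimes> (x \<otimes> x)"
      using lc x(1) unfolding y_def[symmetric] z_def[symmetric] by algebra
    also have "\<dots> = \<zero>"
      using sum x by (simp add: y_def z_def)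
    finally show False
      using nonsquare[of "z \<otimes> x"] lc x(1) by (simp add: z_def minus_equality)
  qed
  then have "degree a = 0"
    using deg0 deg_u u dP by (simp add: univ_poly_zero[of R "carrier R", symmetric])
  then show "a \<in> poly_of_const ` carrier R"
    using a poly_of_const_over_carrier by simp
qed

section \<open>The units of the conic ring\<close>

text \<open>For a general ring this subset need not be closed under addition. It is a field for the conic ring,
  and it is chosen because ring isomorphisms preserve it.\<close>

abbreviation units_with_zero :: "('a, 'm) ring_scheme \<Rightarrow> ('a, 'm) ring_scheme"
  where "units_with_zero A \<equiv> A\<lparr>carrier := insert \<zero>\<^bsub>A\<^esub> (Units A)\<rparr>"

lemma ring_hom_Units:
  assumes "h \<in> ring_hom A B" and "x \<in> Units A"
  shows "h x \<in> Units B"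
proof -
  obtain y where "y \<in> carrier A" "x \<in> carrier A" "y \<otimes>\<^bsub>A\<^esub> x = \<one>\<^bsub>A\<^esub>" "x \<otimes>\<^bsub>A\<^esub> y = \<one>\<^bsub>A\<^esub>"
    using assms(2) by (auto simp: Units_def)
  then show ?thesis
    using ring_hom_memE[OF assms(1)] unfolding Units_def
    by (intro CollectI conjI bexI[of _ "h y"]) metis+
qed

lemma ring_iso_restrict_carrier:
  assumes "h \<in> ring_iso A B" and "U \<subseteq> carrier A"
  shows "h \<in> ring_iso (A\<lparr>carrier := U\<rparr>) (B\<lparr>carrier := h ` U\<rparr>)"
  using assms inj_on_subset[of h "carrier A" U]
  by (auto simp: ring_iso_def ring_hom_def bij_betw_def subset_iff)

lemma units_with_zero_cong:
  assumes "ring A" "ring B" "A \<simeq> B"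
  shows "units_with_zero A \<simeq> units_with_zero B"
proof -
  interpret A: ring A by fact
  interpret B: ring B by fact
  obtain h where h: "h \<in> ring_iso A B"
    using assms(3) by (auto simp: is_ring_iso_def)
  define g where "g = inv_into (carrier A) h"
  have g: "g \<in> ring_iso B A"
    using ring_iso_set_sym[OF assms(1) h] by (simp add: g_def)
  have hg: "h (g y) = y" if "y \<in> carrier B" for y
    using ring_iso_memE(5)[OF h] that by (simp add: g_def bij_betw_inv_into_right)
  have "h ` Units A = Units B"
  proof
    show "h ` Units A \<subseteq> Units B"
      using ring_hom_Units[of h A B] h by (auto simp: ring_iso_def)
    show "Units B \<subseteq> h ` Units A"
    proof
      fix y assume "y \<in> Units B"
      then show "y \<in> h ` Units A"
        using ring_hom_Units[of g B A] g hg[of y] unfolding ring_iso_def by (intro image_eqI[of _ _ "g y"]) auto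
    qed
  qed
  moreover have "h \<zero>\<^bsub>A\<^esub> = \<zero>\<^bsub>B\<^esub>"
    using ring_hom_zero[of h A B] h assms by (simp add: ring_iso_def)
  ultimately have "h ` insert \<zero>\<^bsub>A\<^esub> (Units A) = insert \<zero>\<^bsub>B\<^esub> (Units B)"
    by simp
  moreover have "insert \<zero>\<^bsub>A\<^esub> (Units A) \<subseteq> carrier A"
    by auto
  ultimately have "h \<in> ring_iso (units_with_zero A) (units_with_zero B)"
    using ring_iso_restrict_carrier[OF h] by metis
  then show ?thesis
    by (auto simp: is_ring_iso_def)
qed

context field
begin

text \<open>The quadratic is built over \<open>F[X]\<close>: its constant term \<open>X\<^sup>2 + 1\<close> is the inner instance
  \<open>quadratic \<one>\<close> over \<open>F\<close>.\<close>

lemma conic_ring_eq_quadratic_extension: "conic_ring R = domain.quadratic_extension (poly_ring R) (quadratic \<one>)"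
proof -
  let ?P = "poly_ring R" and ?Q = "poly_ring (poly_ring R)"
  interpret P: domain ?P by (rule univ_poly_is_domain[OF carrier_is_subring])
  interpret Q: domain ?Q by (rule P.univ_poly_is_domain[OF P.carrier_is_subring])
  interpret C: ring_hom_ring ?P ?Q P.poly_of_const by (rule P.poly_of_const_ring_hom_ring)
  have x: "X\<^bsub>R\<^esub> \<in> carrier ?P" by (rule var_closed(1)[OF carrier_is_subring])
  have y: "X\<^bsub>?P\<^esub> \<in> carrier ?Q" by (rule P.var_closed(1)[OF P.carrier_is_subring])
  have one: "poly_of_const \<one> = \<one>\<^bsub>?P\<^esub>"
    by (simp add: poly_of_const_def univ_poly_one)
  let ?u = "P.poly_of_const X\<^bsub>R\<^esub>"
  have u: "?u \<in> carrier ?Q" using x by (rule C.hom_closed)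
  have "X\<^bsub>R\<^esub> [^]\<^bsub>?P\<^esub> (2::nat) = X\<^bsub>R\<^esub> \<otimes>\<^bsub>?P\<^esub> X\<^bsub>R\<^esub>"
    and u2: "?u [^]\<^bsub>?Q\<^esub> (2::nat) = ?u \<otimes>\<^bsub>?Q\<^esub> ?u"
    using x u by (simp_all add: numeral_2_eq_2)
  then have c: "P.poly_of_const (quadratic \<one>) = ?u [^]\<^bsub>?Q\<^esub> (2::nat) \<oplus>\<^bsub>?Q\<^esub> \<one>\<^bsub>?Q\<^esub>"
    unfolding quadratic_def one u2 using x by simp
  have "Y \<oplus>\<^bsub>?Q\<^esub> (Z \<oplus>\<^bsub>?Q\<^esub> \<one>\<^bsub>?Q\<^esub>) = Z \<oplus>\<^bsub>?Q\<^esub> Y \<oplus>\<^bsub>?Q\<^esub> \<one>\<^bsub>?Q\<^esub>"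
    if "Y \<in> carrier ?Q" "Z \<in> carrier ?Q" for Y Z
    using that by algebra
  then have "P.quadratic (quadratic \<one>) = ?u [^]\<^bsub>?Q\<^esub> (2::nat)
      \<oplus>\<^bsub>?Q\<^esub> X\<^bsub>?P\<^esub> [^]\<^bsub>?Q\<^esub> (2::nat) \<oplus>\<^bsub>?Q\<^esub> \<one>\<^bsub>?Q\<^esub>"
    unfolding P.quadratic_def c using Q.nat_pow_closed[OF y] Q.nat_pow_closed[OF u] by blast
  then show ?thesis
    by (simp only: conic_ring_def Let_def)
qed

lemma quadratic_one_closed: "quadratic \<one> \<in> carrier (poly_ring R)"
  by (rule quadratic_closed) simp

lemma conic_ring_is_ring: "ring (conic_ring R)"
  unfolding conic_ring_eq_quadratic_extension
  using domain.residue_ring_hom_ring[OF univ_poly_is_domain[OF carrier_is_subring]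
      quadratic_one_closed]
  by (rule ring_hom_ring.axioms(2))

text \<open>The isomorphism is the embedding of constants. Its image contains all units because a unit
  \<open>a + b Y\<close> has a norm that is a unit of \<open>F[X]\<close>, which forces \<open>b = 0\<close> and \<open>a\<close> constant.\<close>

lemma iso_units_conic_ring:
  assumes nonsquare: "\<And>x. x \<in> carrier R \<Longrightarrow> x \<otimes> x \<noteq> \<ominus> \<one>"
  shows "R \<simeq> units_with_zero (conic_ring R)"
proof -
  let ?P = "poly_ring R" and ?Q = "poly_ring (poly_ring R)"
  interpret P: domain ?P by (rule univ_poly_is_domain[OF carrier_is_subring])
  define A where "A = conic_ring R"
  define d where "d = quadratic \<one>"
  define res where "res = P.residue d"
  have A_eq: "A = P.quadratic_extension d"
    unfolding A_def d_def by (rule conic_ring_eq_quadratic_extension)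
  have d: "d \<in> carrier ?P"
    unfolding d_def by (rule quadratic_one_closed)
  have d_eq: "d = X\<^bsub>R\<^esub> [^]\<^bsub>?P\<^esub> (2::nat) \<oplus>\<^bsub>?P\<^esub> \<one>\<^bsub>?P\<^esub>"
    by (simp add: d_def quadratic_def poly_of_const_def univ_poly_one)
  interpret A: ring A
    unfolding A_def by (rule conic_ring_is_ring)
  define h where "h = res \<circ> (P.poly_of_const \<circ> poly_of_const)"
  have h_hom: "h \<in> ring_hom R A"
    unfolding h_def A_eq res_def
    by (rule ring_hom_trans[OF ring_hom_trans[OF
      ring_hom_ring.homh[OF poly_of_const_ring_hom_ring]
      ring_hom_ring.homh[OF P.poly_of_const_ring_hom_ring]]
      ring_hom_ring.homh[OF P.residue_ring_hom_ring[OF d]]])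
  interpret h: ring_hom_ring R A h
    by (rule ring_hom_ringI2[OF ring_axioms A.ring_axioms h_hom])
  have kernel: "k = \<zero>" if k: "k \<in> carrier R" "h k = \<zero>\<^bsub>A\<^esub>" for k
  proof -
    have "poly_of_const k \<in> carrier ?P"
      using ring_hom_memE(1)[OF ring_hom_ring.homh[OF poly_of_const_ring_hom_ring] k(1)] .
    then have "poly_of_const k = \<zero>\<^bsub>?P\<^esub>"
      using P.residue_const_eq_zeroD[OF d] k(2) unfolding h_def res_def A_eq comp_def by blast
    then show ?thesis
      by (simp add: poly_of_const_def univ_poly_zero split: if_splits)
  qed
  have inj: "inj_on h (carrier R)"
  proof (rule inj_onI)
    fix k l assume kl: "k \<in> carrier R" "l \<in> carrier R" "h k = h l"
    then have "h (k \<ominus> l) = \<zero>\<^bsub>A\<^esub>"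
      by (simp add: a_minus_def A.r_neg)
    then show "k = l"
      using kernel[of "k \<ominus> l"] kl by simp
  qed
  have "h k \<in> insert \<zero>\<^bsub>A\<^esub> (Units A)" if k: "k \<in> carrier R" for k
    using ring_hom_Units[OF h_hom, of k] field_Units k h.hom_zero by (cases "k = \<zero>") auto
  then have "h ` carrier R \<subseteq> insert \<zero>\<^bsub>A\<^esub> (Units A)"
    by blast
  moreover have "u \<in> h ` carrier R" if u: "u \<in> Units A" for u
  proof -
    obtain a b where a: "a \<in> carrier ?P" and b: "b \<in> carrier ?P"
      and u_lin: "u = res (P.linear a b)"
      and "a \<otimes>\<^bsub>?P\<^esub> a \<oplus>\<^bsub>?P\<^esub> d \<otimes>\<^bsub>?P\<^esub> (b \<otimes>\<^bsub>?P\<^esub> b) \<in> Units ?P"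
      using P.unit_quadratic_extensionE[OF d] u unfolding A_eq res_def by blast
    then have "b = []" "a \<in> poly_of_const ` carrier R"
      using norm_unit_imp_const[OF nonsquare d_eq a b] by blast+
    then obtain k where k: "k \<in> carrier R" "a = poly_of_const k" and b0: "b = \<zero>\<^bsub>?P\<^esub>"
      by (auto simp: univ_poly_zero)
    have "P.linear a b = P.poly_of_const a"
      unfolding b0 P.linear_eq_normalize[OF a P.zero_closed] by (simp add: P.poly_of_const_def)
    then show ?thesis
      using u_lin k by (auto simp: h_def)
  qed
  moreover have "\<zero>\<^bsub>A\<^esub> \<in> h ` carrier R"
    using h.hom_zero[symmetric] by (rule image_eqI) simp
  ultimately have "h ` carrier R = insert \<zero>\<^bsub>A\<^esub> (Units A)"
    by blast
  then have "h \<in> ring_iso R (units_with_zero A)"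
    using h_hom inj by (auto simp: ring_iso_def ring_hom_def bij_betw_def)
  then show ?thesis
    by (auto simp: is_ring_iso_def A_def)
qed

end

lemma (in formally_real_field) square_neq_minus_one:
  assumes "x \<in> carrier F"
  shows "x \<otimes> x \<noteq> \<ominus> \<one>"
  using minus_one_not_sum_of_squares[of "\<lambda>_. x" 1] assms
  by (simp add: numeral_2_eq_2 lessThan_Suc)

theorem mainTheorem2:
  fixes F :: "('a, 'm) ring_scheme" and F' :: "('b, 'n) ring_scheme"
  assumes "real_closed_field F" and "real_closed_field F'"
    and "\<not> F \<simeq> F'"
  shows "\<not> conic_ring F \<simeq> conic_ring F'"
proof
  interpret F: real_closed_field F by fact
  interpret F': real_closed_field F' by fact
  assume "conic_ring F \<simeq> conic_ring F'"
  then have "units_with_zero (conic_ring F) \<simeq> units_with_zero (conic_ring F')"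
    by (intro units_with_zero_cong F.conic_ring_is_ring F'.conic_ring_is_ring)
  then have "F \<simeq> units_with_zero (conic_ring F')"
    using ring_iso_trans F.iso_units_conic_ring F.square_neq_minus_one by blast
  moreover have "units_with_zero (conic_ring F') \<simeq> F'"
    using ring_iso_sym[OF F'.ring_axioms] F'.iso_units_conic_ring F'.square_neq_minus_one by blast
  ultimately show False
    using ring_iso_trans assms(3) by blast
qed

end
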